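(* Let $d \geq 1$ and let $A$ be a finite, non-empty subset of $\mathbb{R}^d$ such that $\dim(A) = d$. Suppose that, for some $v \in \mathbb{R}^d \setminus \{0\}$, the set $A$ is contained in a union of $r$ translates of the line $L_v = \{\lambda v : \lambda \in \mathbb{R}\}$. Then \[ |(A-A) \setminus L_v| \geq (2d-2)|A| - 2d^2 r. \]
   Context: For finite sets $A, B \subseteq \mathbb{R}^d$, $A - B = \{a-b : a \in A,\ b \in B\}$. For a non-empty set $A \subseteq \mathbb{R}^d$, $\dim(A)$ denotes the dimension of the affine subspace spanned by $A$. *)

theory Defs
  imports "HOL-Analysis.Analysis"
begin

text \<open>The operator \<open>-\<close> on sets is set-theoretic difference, so the difference set
  \<open>{a - b. a \<in> A, b \<in> B}\<close> needs its own name.\<close>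

definition diffset :: "'a::minus set \<Rightarrow> 'a set \<Rightarrow> 'a set"
  where "diffset A B = {a - b |a b. a \<in> A \<and> b \<in> B}"

definition line_through_0 :: "'a::real_vector \<Rightarrow> 'a set"
  where "line_through_0 v = {c *\<^sub>R v |c. c \<in> (UNIV :: real set)}"

end

theory Submission
  imports Defs
begin

text \<open>
  Project \<open>A\<close> along \<open>v\<close> to a set \<open>B\<close> of dimension \<open>n \<ge> d - 1\<close> and give \<open>b \<in> B\<close> the weight
  \<open>a b = |fibre of b| - 1\<close>. The fibre of \<open>A - A\<close> over \<open>b - b'\<close> has at least \<open>a b + a b'\<close> elements,
  so it suffices to show that any function \<open>g\<close> with \<open>g (b - b') \<ge> a b + a b'\<close> sums over the nonzero
  differences to at least \<open>2 n\<close> times the total weight of \<open>B\<close>; no error term is needed there.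

  Let \<open>T\<close> be the heaviest facet of \<open>B\<close> and \<open>S\<close> the opposite face, which lies in a facet and hence is
  not heavier than \<open>T\<close>. The differences in \<open>\<plusminus>(T - S)\<close> are not differences of points of \<open>B\<close>
  outside \<open>S\<close>, and by a weighted form of Ruzsa's sumset inequality they contribute at least
  \<open>2 (weight T + n * weight S)\<close>. Removing \<open>S\<close> either keeps the dimension or leaves
  just \<open>T\<close>, and in both cases induction applies to what remains.

  For the sumset inequality, a facet of \<open>T + S\<close> is the sum of a face of \<open>T\<close> and a face of \<open>S\<close>.
  Bound that sum by induction on the dimension, and remove the lighter of the two faces, say from
  \<open>T\<close>; this is harmless as long as \<open>S\<close> alone has the required dimension. If it has not, \<open>T\<close> meets
  many cosets of the direction space of \<open>S\<close>, and these contribute disjoint sums.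
\<close>

section \<open>Faces and facets of finite point sets\<close>

definition max_face :: "'a::real_inner \<Rightarrow> 'a set \<Rightarrow> 'a set" where
  "max_face l B = {x \<in> B. \<forall>y\<in>B. l \<bullet> y \<le> l \<bullet> x}"

lemma max_face_subset: "max_face l B \<subseteq> B"
  by (auto simp: max_face_def)

lemma finite_max_face: "finite B \<Longrightarrow> finite (max_face l B)"
  by (simp add: max_face_def)

lemma max_face_eq_hyperplane_Int:
  assumes "x \<in> max_face l B"
  shows "max_face l B = {y \<in> B. l \<bullet> y = l \<bullet> x}"
  using assms by (force simp: max_face_def)

lemma max_face_nonempty:
  assumes "finite B" "B \<noteq> {}"
  shows "max_face l B \<noteq> {}"
proof -
  obtain x where "x \<in> B" "(MAX y\<in>B. l \<bullet> y) = l \<bullet> x"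
    using obtains_MAX[OF assms] by metis
  moreover from this have "l \<bullet> y \<le> l \<bullet> x" if "y \<in> B" for y
    using assms that by (metis Max_ge finite_imageI imageI)
  ultimately show ?thesis
    by (auto simp: max_face_def)
qed

lemma max_face_disjoint_opposite:
  assumes "max_face l B \<noteq> B"
  shows "max_face l B \<inter> max_face (- l) B = {}"
  using assms by (force simp: max_face_def)

lemma plus_in_max_face_iff:
  assumes "t \<in> T" "s \<in> S"
  shows "t + s \<in> max_face l (T + S) \<longleftrightarrow> t \<in> max_face l T \<and> s \<in> max_face l S"
proof
  assume max: "t + s \<in> max_face l (T + S)"
  have "l \<bullet> t' \<le> l \<bullet> t" if "t' \<in> T" for t'
    using max set_plus_intro[OF that assms(2)] by (auto simp: max_face_def inner_add_right)
  moreover have "l \<bullet> s' \<le> l \<bullet> s" if "s' \<in> S" for s'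
    using max set_plus_intro[OF assms(1) that] by (auto simp: max_face_def inner_add_right)
  ultimately show "t \<in> max_face l T \<and> s \<in> max_face l S"
    using assms by (simp add: max_face_def)
next
  assume "t \<in> max_face l T \<and> s \<in> max_face l S"
  then show "t + s \<in> max_face l (T + S)"
    by (auto simp: max_face_def inner_add_right intro!: add_mono elim!: set_plus_elim)
qed

lemma max_face_set_plus: "max_face l (T + S) = max_face l T + max_face l S"
proof
  show "max_face l (T + S) \<subseteq> max_face l T + max_face l S"
  proof
    fix x assume x: "x \<in> max_face l (T + S)"
    then obtain t s where "x = t + s" "t \<in> T" "s \<in> S"
      using max_face_subset by (blast elim: set_plus_elim)
    then show "x \<in> max_face l T + max_face l S"
      using x plus_in_max_face_iff by blast
  qed
  show "max_face l T + max_face l S \<subseteq> max_face l (T + S)"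
  proof
    fix x assume "x \<in> max_face l T + max_face l S"
    then obtain t s where "x = t + s" "t \<in> max_face l T" "s \<in> max_face l S"
      by (rule set_plus_elim)
    then show "x \<in> max_face l (T + S)"
      using max_face_subset plus_in_max_face_iff by blast
  qed
qed

lemma aff_dim_Int_face_of_convex_hull:
  fixes B :: "'a::euclidean_space set"
  assumes "compact B" and "F face_of convex hull B"
  shows "aff_dim (B \<inter> F) = aff_dim F"
proof -
  obtain B' where B': "B' \<subseteq> B" "F = convex hull B'"
    using face_of_convex_hull_subset[OF assms] .
  have "B' \<subseteq> B \<inter> F"
    using B' hull_subset[of B' convex] by blast
  then have "aff_dim F \<le> aff_dim (B \<inter> F)"
    using B'(2) by (metis aff_dim_convex_hull aff_dim_subset)
  moreover have "aff_dim (B \<inter> F) \<le> aff_dim F"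
    by (simp add: aff_dim_subset)
  ultimately show ?thesis
    by simp
qed

definition facet_normals :: "'a::euclidean_space set \<Rightarrow> 'a set" where
  "facet_normals B = {l. aff_dim (max_face l B) = aff_dim B - 1}"

lemma facet_normal_max_face_neq: "l \<in> facet_normals B \<Longrightarrow> max_face l B \<noteq> B"
  by (auto simp: facet_normals_def)

lemma facet_of_convex_hull_eq_max_face:
  fixes B :: "'a::euclidean_space set"
  assumes "finite B" and F: "F facet_of convex hull B"
  obtains l where "l \<in> facet_normals B" "max_face l B = B \<inter> F"
proof -
  have "polyhedron (convex hull B)"
    using assms(1) by (simp add: polyhedron_convex_hull)
  then obtain l \<beta> where hull_le: "convex hull B \<subseteq> {y. l \<bullet> y \<le> \<beta>}"
    and F_eq: "F = convex hull B \<inter> {y. l \<bullet> y = \<beta>}"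
    using facet_of_polyhedron[OF _ F] by metis
  have aff_dim_eq: "aff_dim (B \<inter> F) = aff_dim F"
    using assms by (intro aff_dim_Int_face_of_convex_hull finite_imp_compact facet_of_imp_face_of)
  have "F \<noteq> {}"
    using F by (simp add: facet_of_def)
  then have "B \<inter> F \<noteq> {}"
    using aff_dim_eq by (metis aff_dim_empty)
  then obtain x where x: "x \<in> B" "l \<bullet> x = \<beta>"
    by (auto simp: F_eq)
  then have "x \<in> max_face l B"
    using hull_le by (auto simp: max_face_def dest: hull_inc)
  then have "max_face l B = B \<inter> F"
    using max_face_eq_hyperplane_Int[of x l B] x(2) hull_subset[of B convex] by (auto simp: F_eq)
  moreover from this have "l \<in> facet_normals B"
    using F aff_dim_eq by (simp add: facet_normals_def facet_of_def aff_dim_convex_hull)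
  ultimately show ?thesis
    using that by blast
qed

lemma max_face_subset_facet:
  fixes B :: "'a::euclidean_space set"
  assumes "finite B" and "max_face l B \<noteq> B"
  obtains l' where "l' \<in> facet_normals B" "max_face l B \<subseteq> max_face l' B"
proof -
  have "B \<noteq> {}"
    using assms(2) max_face_subset by fastforce
  then obtain x where x: "x \<in> max_face l B"
    using max_face_nonempty[OF assms(1)] by blast
  let ?P = "convex hull B" and ?H = "{y. l \<bullet> y = l \<bullet> x}"
  have max_face_eq: "max_face l B = B \<inter> ?H"
    using max_face_eq_hyperplane_Int[OF x] by blast
  have "?P \<subseteq> {y. l \<bullet> y \<le> l \<bullet> x}"
    using x by (intro hull_minimal) (auto simp: max_face_def convex_halfspace_le)
  then have "?P \<inter> ?H face_of ?P"
    by (intro face_of_Int_supporting_hyperplane_le) auto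
  moreover have "?P \<inter> ?H \<noteq> {}" "?P \<inter> ?H \<noteq> ?P"
    using x assms(2) max_face_eq hull_subset[of B convex] by blast+
  ultimately obtain F where F: "F facet_of ?P" "?P \<inter> ?H \<subseteq> F"
    using face_of_polyhedron_subset_facet[OF polyhedron_convex_hull] assms(1) by metis
  then have "max_face l B \<subseteq> B \<inter> F"
    using hull_subset[of B convex] by (auto simp: max_face_eq)
  then show ?thesis
    using facet_of_convex_hull_eq_max_face[OF assms(1) F(1)] that by metis
qed

lemma facet_normals_nonempty:
  fixes B :: "'a::euclidean_space set"
  assumes "finite B" and "1 \<le> aff_dim B"
  shows "facet_normals B \<noteq> {}"
proof -
  obtain p where p: "p \<in> B"
    using assms(2) by fastforce
  have "B \<noteq> {p}"
    using assms(2) by auto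
  then obtain q where q: "q \<in> B" "q \<noteq> p"
    using p by blast
  then have "0 < (q - p) \<bullet> (q - p)"
    by simp
  then have "p \<notin> max_face (q - p) B"
    using q by (force simp: max_face_def inner_diff_right)
  then show ?thesis
    using max_face_subset_facet[OF assms(1), of "q - p"] p by blast
qed

lemma eq_facetI:
  assumes "l \<in> facet_normals B" and "max_face l B \<subseteq> X" "X \<subseteq> B" and "aff_dim X < aff_dim B"
  shows "X = max_face l B"
proof
  let ?T = "max_face l B"
  show "X \<subseteq> ?T"
  proof
    fix x assume "x \<in> X"
    have "aff_dim (insert x ?T) \<le> aff_dim X"
      using \<open>x \<in> X\<close> assms(2) by (intro aff_dim_subset) auto
    also have "\<dots> \<le> aff_dim ?T"
      using assms(1,4) by (simp add: facet_normals_def)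
    finally have x: "x \<in> affine hull ?T"
      by (auto simp: aff_dim_insert split: if_splits)
    then have "?T \<noteq> {}"
      by auto
    then obtain y where "y \<in> ?T"
      by blast
    then have T_eq: "?T = {z \<in> B. l \<bullet> z = l \<bullet> y}"
      by (rule max_face_eq_hyperplane_Int)
    have "affine hull ?T \<subseteq> {z. l \<bullet> z = l \<bullet> y}"
      by (rule hull_minimal) (auto simp: T_eq affine_hyperplane)
    then show "x \<in> ?T"
      using x \<open>x \<in> X\<close> assms(3) T_eq by auto
  qed
qed (rule assms(2))

section \<open>Projections along a subspace\<close>

definition projection_along :: "'a::real_vector set \<Rightarrow> ('a \<Rightarrow> 'a) \<Rightarrow> bool" where
  "projection_along U q \<longleftrightarrow> linear q \<and> (\<forall>x. x - q x \<in> U) \<and> (\<forall>x\<in>U. q x = 0)"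

lemma projection_along_exists:
  fixes U :: "'a::euclidean_space set"
  assumes "subspace U"
  obtains q where "projection_along U q"
proof -
  obtain B where B: "pairwise orthogonal B" "span B = U"
    using orthogonal_basis_subspace[OF assms] by metis
  define p where "p x = (\<Sum>b\<in>B. (b \<bullet> x / (b \<bullet> b)) *\<^sub>R b)" for x
  have "p x \<in> U" for x
    unfolding p_def B(2)[symmetric] by (intro span_sum span_scale span_base)
  moreover have "x - p x = 0" if "x \<in> U" for x
  proof -
    have "x - p x \<in> span B"
      using that \<open>p x \<in> U\<close> assms by (simp add: B(2) subspace_diff)
    then have "orthogonal (x - p x) (x - p x)"
      unfolding p_def by (rule Gram_Schmidt_step[OF B(1)])
    then show ?thesis
      by (simp add: orthogonal_def)
  qed
  moreover have "linear p"
    unfolding p_def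
    by (intro linear_compose_sum ballI)
      (auto intro!: linearI simp: inner_add_right add_divide_distrib scaleR_left_distrib)
  then have "linear (\<lambda>x. x - p x)"
    using linear_compose_sub[OF linear_ident] by blast
  ultimately show ?thesis
    by (intro that[of "\<lambda>x. x - p x"]) (simp add: projection_along_def)
qed

lemma projection_along_eq_iff:
  assumes "projection_along U q"
  shows "q x = q y \<longleftrightarrow> x - y \<in> U"
proof -
  have "q x = q y \<longleftrightarrow> q (x - y) = 0"
    using assms by (simp add: projection_along_def linear_diff)
  also have "\<dots> \<longleftrightarrow> x - y \<in> U"
    using assms unfolding projection_along_def by (metis diff_zero)
  finally show ?thesis .
qed

lemma projection_along_eq_0_iff:
  "projection_along U q \<Longrightarrow> q x = 0 \<longleftrightarrow> x \<in> U"
  using projection_along_eq_iff[of U q x 0] by (simp add: projection_along_def linear_0)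

lemma aff_dim_le_projection_along:
  fixes A :: "'a::euclidean_space set"
  assumes "projection_along U q" and "subspace U"
  shows "aff_dim A \<le> aff_dim (q ` A) + int (dim U)"
proof (cases "A = {}")
  case False
  then obtain x0 where x0: "x0 \<in> A"
    by blast
  define D where "D = (\<lambda>y. y - q x0) ` q ` A"
  let ?sums = "{x + y |x y. x \<in> span D \<and> y \<in> U}"
  have "(\<lambda>x. x - x0) ` A \<subseteq> ?sums"
  proof
    fix z assume "z \<in> (\<lambda>x. x - x0) ` A"
    then obtain x where x: "x \<in> A" "z = x - x0"
      by blast
    have "q (x - x0) \<in> span D"
      using x(1) assms(1)
      by (intro span_base) (auto simp: D_def projection_along_def linear_diff)
    moreover have "(x - x0) - q (x - x0) \<in> U"
      using assms(1) by (simp add: projection_along_def)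
    ultimately show "z \<in> ?sums"
      unfolding x(2) by force
  qed
  then have "dim ((\<lambda>x. x - x0) ` A) \<le> dim ?sums"
    by (rule dim_subset)
  also have "\<dots> \<le> dim D + dim U"
    using dim_sums_Int[OF subspace_span assms(2), of D] by simp
  finally show ?thesis
    using aff_dim_eq_dim_subtract[OF hull_inc[OF x0]]
      aff_dim_eq_dim_subtract[OF hull_inc[OF imageI[OF x0, of q]]]
    by (simp add: D_def)
qed simp

section \<open>Weighted sumsets\<close>

definition dominates_sums ::
    "('a::plus \<Rightarrow> real) \<Rightarrow> ('a \<Rightarrow> real) \<Rightarrow> 'a set \<Rightarrow> ('a \<Rightarrow> real) \<Rightarrow> 'a set \<Rightarrow> bool" where
  "dominates_sums g a T c S \<longleftrightarrow>
     (\<forall>t\<in>T. 0 \<le> a t) \<and> (\<forall>s\<in>S. 0 \<le> c s) \<and> (\<forall>t\<in>T. \<forall>s\<in>S. a t + c s \<le> g (t + s))"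

lemma dominates_sums_commute:
  fixes T :: "'a::ab_semigroup_add set"
  shows "dominates_sums g a T c S \<longleftrightarrow> dominates_sums g c S a T"
proof -
  have "a t + c s \<le> g (t + s) \<longleftrightarrow> c s + a t \<le> g (s + t)" for t s
    by (simp add: add.commute)
  then show ?thesis
    by (auto simp: dominates_sums_def)
qed

lemma dominates_sums_mono:
  "dominates_sums g a T c S \<Longrightarrow> T' \<subseteq> T \<Longrightarrow> S' \<subseteq> S \<Longrightarrow> dominates_sums g a T' c S'"
  by (simp add: dominates_sums_def subset_iff)

lemma dominates_sums_nonneg:
  assumes "dominates_sums g a T c S" and "x \<in> T + S"
  shows "0 \<le> g x"
  using assms(2)
proof (rule set_plus_elim)
  fix t s assume "x = t + s" "t \<in> T" "s \<in> S"
  moreover from this have "0 \<le> a t + c s" "a t + c s \<le> g (t + s)"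
    using assms(1) by (auto simp: dominates_sums_def)
  ultimately show ?thesis
    by simp
qed

text \<open>A weighted form of Ruzsa's bound \<open>|T + S| \<ge> |T| + d |S| - O(1)\<close> for \<open>|S| \<le> |T|\<close>.\<close>

definition sumset_bound ::
    "nat \<Rightarrow> ('a::plus \<Rightarrow> real) \<Rightarrow> ('a \<Rightarrow> real) \<Rightarrow> 'a set \<Rightarrow> ('a \<Rightarrow> real) \<Rightarrow> 'a set \<Rightarrow> bool" where
  "sumset_bound e g a T c S \<longleftrightarrow>
     sum a T + sum c S + real e * min (sum a T) (sum c S) \<le> sum g (T + S)"

lemma sumset_bound_commute:
  fixes T :: "'a::ab_semigroup_add set"
  shows "sumset_bound e g a T c S \<longleftrightarrow> sumset_bound e g c S a T"
  by (simp add: sumset_bound_def add.commute[of T] add.commute[of "sum a T"] min.commute)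

lemma sumset_bound_0:
  fixes T S :: "'a::cancel_ab_semigroup_add set"
  assumes "finite T" "T \<noteq> {}" "finite S" "S \<noteq> {}" and "dominates_sums g a T c S"
  shows "sumset_bound 0 g a T c S"
  using assms
proof (induction "card T" "card S" arbitrary: T S a c rule: linorder_wlog)
  case le
  obtain t where t: "t \<in> T" "(MAX x\<in>T. a x) = a t"
    using obtains_MAX[OF le(2,3)] by metis
  have "a x \<le> a t" if "x \<in> T" for x
    using le(2) that by (metis Max_ge finite_imageI imageI t(2))
  then have "sum a T \<le> real (card T) * a t"
    using sum_bounded_above by metis
  also have "\<dots> \<le> real (card S) * a t"
    using le(1,6) t(1) by (simp add: dominates_sums_def mult_right_mono)
  finally have "sum a T + sum c S \<le> (\<Sum>s\<in>S. a t + c s)"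
    by (simp add: sum.distrib)
  also have "\<dots> \<le> (\<Sum>s\<in>S. g (t + s))"
    using le(6) t(1) by (intro sum_mono) (simp add: dominates_sums_def)
  also have "\<dots> = sum g ((+) t ` S)"
    by (simp add: sum.reindex inj_on_def)
  also have "\<dots> \<le> sum g (T + S)"
    using le t(1) by (intro sum_mono2) (auto simp: finite_set_plus dominates_sums_nonneg)
  finally show ?case
    by (simp add: sumset_bound_def)
next
  case sym
  then have "sumset_bound 0 g c S a T"
    using dominates_sums_commute[of g a T c S] by simp
  then show ?case
    by (simp add: sumset_bound_commute)
qed

lemma min_sum_le_sum_min:
  fixes f :: "'b \<Rightarrow> 'a::linordered_idom"
  assumes "finite R" and "\<And>r. r \<in> R \<Longrightarrow> 0 \<le> f r" and "0 \<le> s"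
  shows "min (sum f R) s \<le> (\<Sum>r\<in>R. min (f r) s)"
  using assms
proof (induction R)
  case (insert r R)
  then have "0 \<le> f r" "0 \<le> sum f R"
    by (auto intro: sum_nonneg)
  then have "min (f r + sum f R) s \<le> min (f r) s + min (sum f R) s"
    using \<open>0 \<le> s\<close> by (simp add: min_def)
  also have "\<dots> \<le> min (f r) s + (\<Sum>r\<in>R. min (f r) s)"
    using insert by (intro add_left_mono) simp
  finally show ?case
    using insert.hyps by simp
qed simp

subsection \<open>Splitting into fibres\<close>

definition fibre :: "('a \<Rightarrow> 'b) \<Rightarrow> 'a set \<Rightarrow> 'b \<Rightarrow> 'a set" where
  "fibre q A b = {x \<in> A. q x = b}"

lemma sum_eq_sum_fibres:
  assumes "finite A" "finite B" "q ` A \<subseteq> B"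
  shows "sum f A = (\<Sum>b\<in>B. sum f (fibre q A b))"
  unfolding fibre_def using sum.group[OF assms] by (rule sym)

lemma card_eq_sum_card_fibres:
  "finite A \<Longrightarrow> finite B \<Longrightarrow> q ` A \<subseteq> B \<Longrightarrow> card A = (\<Sum>b\<in>B. card (fibre q A b))"
  unfolding card_eq_sum by (rule sum_eq_sum_fibres)

lemma sum_set_plus_eq_sum_fibres:
  fixes q :: "'a::plus \<Rightarrow> 'b::group_add"
  assumes "finite T" "finite S" and q: "\<And>t s. t \<in> T \<Longrightarrow> s \<in> S \<Longrightarrow> q (t + s) = q t + k"
  shows "sum g (T + S) = (\<Sum>r\<in>q ` T. sum g (fibre q T r + S))"
proof -
  have "(\<lambda>x. q x - k) ` (T + S) \<subseteq> q ` T"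
    using q by (auto elim!: set_plus_elim)
  then have "sum g (T + S) = (\<Sum>r\<in>q ` T. sum g (fibre (\<lambda>x. q x - k) (T + S) r))"
    using assms(1,2) by (intro sum_eq_sum_fibres) (simp_all add: finite_set_plus)
  moreover have "fibre (\<lambda>x. q x - k) (T + S) r = fibre q T r + S" for r
    using q by (force simp: fibre_def set_plus_def)
  ultimately show ?thesis
    by simp
qed

lemma sumset_bound_fibres:
  fixes q :: "'a::plus \<Rightarrow> 'b::group_add"
  assumes fin: "finite T" "finite S" and dom: "dominates_sums g a T c S"
    and q: "\<And>t s. t \<in> T \<Longrightarrow> s \<in> S \<Longrightarrow> q (t + s) = q t + k"
    and many: "e + 1 \<le> f + card (q ` T)" and "f \<le> e"
    and fibre_bound: "\<And>T'. T' \<subseteq> T \<Longrightarrow> T' \<noteq> {} \<Longrightarrow> sumset_bound f g a T' c S"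
  shows "sumset_bound e g a T c S"
proof -
  define m where "m = min (sum a T) (sum c S)"
  let ?C = "fibre q T" and ?N = "real (card (q ` T))"
  have nonneg: "0 \<le> sum a (?C r)" "0 \<le> sum c S" for r
    using dom by (auto simp: fibre_def dominates_sums_def intro!: sum_nonneg)
  have sum_T: "sum a T = (\<Sum>r\<in>q ` T. sum a (?C r))"
    using fin(1) by (intro sum_eq_sum_fibres) auto
  have "real f * m \<le> real f * (\<Sum>r\<in>q ` T. min (sum a (?C r)) (sum c S))"
    unfolding m_def sum_T using fin(1) nonneg by (intro mult_left_mono min_sum_le_sum_min) auto
  then have "sum a T + ?N * sum c S + real f * m
      \<le> (\<Sum>r\<in>q ` T. sum a (?C r) + sum c S + real f * min (sum a (?C r)) (sum c S))"
    by (simp add: sum.distrib sum_T sum_distrib_left)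
  also have "\<dots> \<le> (\<Sum>r\<in>q ` T. sum g (?C r + S))"
  proof (rule sum_mono)
    fix r assume "r \<in> q ` T"
    then have "sumset_bound f g a (?C r) c S"
      by (intro fibre_bound) (auto simp: fibre_def)
    then show "sum a (?C r) + sum c S + real f * min (sum a (?C r)) (sum c S)
        \<le> sum g (?C r + S)"
      by (simp add: sumset_bound_def)
  qed
  also have "\<dots> = sum g (T + S)"
    using fin q by (intro sum_set_plus_eq_sum_fibres[symmetric])
  finally have "sum a T + ?N * sum c S + real f * m \<le> sum g (T + S)" .
  moreover have "(real e - real f) * m \<le> (real e - real f) * sum c S"
    using \<open>f \<le> e\<close> by (intro mult_left_mono) (auto simp: m_def)
  moreover have "(real e - real f + 1) * sum c S \<le> ?N * sum c S"
    using many nonneg(2) by (intro mult_right_mono) linarith+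
  ultimately show ?thesis
    unfolding sumset_bound_def m_def[symmetric] by (simp add: algebra_simps)
qed

lemma map_collapsing_summand_exists:
  fixes T S :: "'a::euclidean_space set"
  assumes "finite T" and "S \<noteq> {}"
  obtains q :: "'a \<Rightarrow> 'a" and k where "\<And>t s. s \<in> S \<Longrightarrow> q (t + s) = q t + k"
    "aff_dim (T + S) < aff_dim S + int (card (q ` T))"
proof -
  obtain s\<^sub>0 where s\<^sub>0: "s\<^sub>0 \<in> S"
    using assms(2) by blast
  define U where "U = span ((\<lambda>s. s - s\<^sub>0) ` S)"
  obtain q where q: "projection_along U q"
    using projection_along_exists[of U] by (auto simp: U_def)
  have "q s = q s\<^sub>0" if "s \<in> S" for s
    using that unfolding projection_along_eq_iff[OF q] U_def by (intro span_base) auto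
  then have q_plus: "q (t + s) = q t + q s\<^sub>0" if "s \<in> S" for t s
    using q that by (simp add: projection_along_def linear_add)
  have "aff_dim (T + S) \<le> aff_dim (q ` (T + S)) + int (dim U)"
    using q by (intro aff_dim_le_projection_along) (simp_all add: U_def)
  also have "int (dim U) = aff_dim S"
    using aff_dim_eq_dim_subtract[OF hull_inc[OF s\<^sub>0]] by (simp add: U_def)
  also have "aff_dim (q ` (T + S)) \<le> aff_dim ((+) (q s\<^sub>0) ` q ` T)"
    using q_plus by (intro aff_dim_subset) (auto simp: add.commute elim!: set_plus_elim)
  also have "\<dots> < int (card (q ` T))"
    using aff_dim_le_card[of "q ` T"] assms(1) by (simp add: aff_dim_translation_eq)
  finally have "aff_dim (T + S) < aff_dim S + int (card (q ` T))"
    by simp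
  then show ?thesis
    using that q_plus by blast
qed

subsection \<open>Removing the lighter face\<close>

lemma sum_max_face_plus_rest_le:
  fixes T S :: "'a::real_inner set"
  assumes fin: "finite T" "finite S" and nonneg: "\<And>x. x \<in> T + S \<Longrightarrow> (0::real) \<le> g x"
  shows "sum g (max_face l T + max_face l S) + sum g ((T - max_face l T) + S) \<le> sum g (T + S)"
proof -
  let ?F = "max_face l T + max_face l S" and ?R = "(T - max_face l T) + S"
  have "?F \<inter> ?R = {}"
    unfolding max_face_set_plus[symmetric] using plus_in_max_face_iff
    by (blast elim: set_plus_elim)
  then have "sum g ?F + sum g ?R = sum g (?F \<union> ?R)"
    using fin by (simp add: sum.union_disjoint finite_set_plus finite_max_face)
  also have "\<dots> \<le> sum g (T + S)"
  proof (rule sum_mono2)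
    show "?F \<union> ?R \<subseteq> T + S"
      by (intro Un_least set_plus_mono2 max_face_subset) auto
  qed (use fin nonneg in \<open>auto simp: finite_set_plus\<close>)
  finally show ?thesis .
qed

lemma sumset_bound_remove_lighter_subset:
  fixes T S :: "'a::plus set"
  assumes "finite T" and "\<And>t. t \<in> T \<Longrightarrow> 0 \<le> a t" and "T\<^sub>1 \<subseteq> T"
    and total: "sum g (T\<^sub>1 + S\<^sub>1) + sum g ((T - T\<^sub>1) + S) \<le> sum g (T + S)"
    and lighter: "sum a T\<^sub>1 \<le> sum c S\<^sub>1"
    and face: "sumset_bound e g a T\<^sub>1 c S\<^sub>1"
    and rest: "sumset_bound (Suc e) g a (T - T\<^sub>1) c S"
  shows "sumset_bound (Suc e) g a T c S"
proof -
  have diff: "sum a (T - T\<^sub>1) = sum a T - sum a T\<^sub>1"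
    using assms(1,3) by (rule sum_diff)
  have "0 \<le> sum a T\<^sub>1"
    using assms(2,3) by (auto intro: sum_nonneg)
  then have "min (sum a T) (sum c S) - sum a T\<^sub>1 \<le> min (sum a (T - T\<^sub>1)) (sum c S)"
    by (simp add: diff min_def)
  then have "real (Suc e) * (min (sum a T) (sum c S) - sum a T\<^sub>1)
      \<le> real (Suc e) * min (sum a (T - T\<^sub>1)) (sum c S)"
    by (intro mult_left_mono) auto
  moreover have "min (sum a T\<^sub>1) (sum c S\<^sub>1) = sum a T\<^sub>1"
    using lighter by simp
  ultimately show ?thesis
    using face rest total lighter diff unfolding sumset_bound_def by (simp add: algebra_simps)
qed

lemma sumset_bound_lighter_summand:
  assumes "finite S" and "S\<^sub>1 \<subseteq> S"
    and total: "sum g (T + S\<^sub>1) + sum g (T + (S - S\<^sub>1)) \<le> sum g (T + S)"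
    and lighter: "sum a T \<le> sum c S\<^sub>1"
    and face: "sumset_bound e g a T c S\<^sub>1"
    and rest: "sumset_bound 0 g a T c (S - S\<^sub>1)"
  shows "sumset_bound (Suc e) g a T c S"
proof -
  have "sum c (S - S\<^sub>1) = sum c S - sum c S\<^sub>1"
    using assms(1,2) by (rule sum_diff)
  moreover have "real (Suc e) * min (sum a T) (sum c S) \<le> real (Suc e) * sum a T"
    by (intro mult_left_mono) auto
  ultimately show ?thesis
    using total lighter face rest unfolding sumset_bound_def by (simp add: algebra_simps)
qed

lemma aff_dim_le_set_plus:
  fixes T S :: "'a::euclidean_space set"
  assumes "S \<noteq> {}"
  shows "aff_dim T \<le> aff_dim (T + S)"
proof -
  obtain s where "s \<in> S"
    using assms by blast
  then have "(+) s ` T \<subseteq> T + S"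
    by (auto simp: set_plus_def add.commute)
  then show ?thesis
    by (metis aff_dim_subset aff_dim_translation_eq)
qed

lemma sumset_bound_low_dim_summand:
  fixes T S :: "'a::euclidean_space set"
  assumes fin: "finite T" "finite S" and "S \<noteq> {}" and dom: "dominates_sums g a T c S"
    and low: "aff_dim S < int e" and dim: "int e \<le> aff_dim (T + S)"
    and smaller: "\<And>f T'. \<lbrakk>f < e; T' \<subseteq> T; T' \<noteq> {}; int f \<le> aff_dim (T' + S)\<rbrakk>
      \<Longrightarrow> sumset_bound f g a T' c S"
  shows "sumset_bound e g a T c S"
proof -
  obtain f where f: "aff_dim S = int f"
    using \<open>S \<noteq> {}\<close> by (metis aff_dim_negative_iff nonneg_int_cases not_less)
  obtain q :: "'a \<Rightarrow> 'a" and k where q: "\<And>t s. s \<in> S \<Longrightarrow> q (t + s) = q t + k"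
    and card: "aff_dim (T + S) < aff_dim S + int (card (q ` T))"
    using map_collapsing_summand_exists[OF fin(1) \<open>S \<noteq> {}\<close>] by metis
  show ?thesis
  proof (rule sumset_bound_fibres[OF fin dom])
    show "e + 1 \<le> f + card (q ` T)" "f \<le> e"
      using card dim low f by linarith+
    show "sumset_bound f g a T' c S" if "T' \<subseteq> T" "T' \<noteq> {}" for T'
      using that low f aff_dim_le_set_plus[of T' S] by (intro smaller) (auto simp: add.commute)
  qed (rule q)
qed

lemma sumset_bound_lighter_face:
  fixes T S :: "'a::euclidean_space set"
  assumes fin: "finite T" "finite S" and "T \<noteq> {}" and dom: "dominates_sums g a T c S"
    and l: "l \<in> facet_normals (T + S)"
    and lighter: "sum a (max_face l T) \<le> sum c (max_face l S)"
    and face: "sumset_bound e g a (max_face l T) c (max_face l S)"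
    and rest: "T - max_face l T \<noteq> {} \<Longrightarrow> sumset_bound (Suc e) g a (T - max_face l T) c S"
  shows "sumset_bound (Suc e) g a T c S"
proof (cases "max_face l T = T")
  case False
  have total: "sum g (max_face l T + max_face l S) + sum g ((T - max_face l T) + S)
      \<le> sum g (T + S)"
    using fin dominates_sums_nonneg[OF dom] by (rule sum_max_face_plus_rest_le)
  have "T - max_face l T \<noteq> {}"
    using False max_face_subset by blast
  moreover have "0 \<le> a t" if "t \<in> T" for t
    using dom that by (simp add: dominates_sums_def)
  ultimately show ?thesis
    using sumset_bound_remove_lighter_subset[OF fin(1) _ max_face_subset total lighter face rest]
    by blast
next
  case True
  have "sum g (max_face l S + max_face l T) + sum g ((S - max_face l S) + T) \<le> sum g (S + T)"
    using fin dom dominates_sums_nonneg[of g a T c S]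
    by (intro sum_max_face_plus_rest_le) (simp_all add: add.commute)
  then have total: "sum g (T + max_face l S) + sum g (T + (S - max_face l S)) \<le> sum g (T + S)"
    by (simp add: True add.commute)
  have "max_face l S \<noteq> S"
    using facet_normal_max_face_neq[OF l] True by (auto simp: max_face_set_plus)
  then have "S - max_face l S \<noteq> {}"
    using max_face_subset by blast
  then have "sumset_bound 0 g a T c (S - max_face l S)"
    using fin \<open>T \<noteq> {}\<close> dominates_sums_mono[OF dom] by (intro sumset_bound_0) auto
  then show ?thesis
    using sumset_bound_lighter_summand[OF fin(2) max_face_subset total] lighter face True by simp
qed

lemma sumset_bound_step:
  fixes T S :: "'a::euclidean_space set"
  assumes fin: "finite T" "finite S" and ne: "T \<noteq> {}" "S \<noteq> {}" and dom: "dominates_sums g a T c S"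
    and dim: "int (Suc e) \<le> aff_dim (T + S)"
    and l: "l \<in> facet_normals (T + S)"
    and lighter: "sum a (max_face l T) \<le> sum c (max_face l S)"
    and smaller: "\<And>f T' S'. \<lbrakk>f + card T' + card S' < Suc e + card T + card S; T' \<subseteq> T; T' \<noteq> {};
      S' \<subseteq> S; S' \<noteq> {}; int f \<le> aff_dim (T' + S')\<rbrakk> \<Longrightarrow> sumset_bound f g a T' c S'"
  shows "sumset_bound (Suc e) g a T c S"
proof (cases "aff_dim S < int (Suc e)")
  case True
  show ?thesis
  proof (rule sumset_bound_low_dim_summand[OF fin ne(2) dom True dim])
    show "sumset_bound f g a T' c S"
      if "f < Suc e" "T' \<subseteq> T" "T' \<noteq> {}" "int f \<le> aff_dim (T' + S)" for f T'
      using that ne(2) card_mono[OF fin(1) that(2)] by (intro smaller) auto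
  qed
next
  case False
  have faces: "max_face l T \<noteq> {}" "max_face l S \<noteq> {}"
    using fin ne by (simp_all add: max_face_nonempty)
  have card_le: "card (max_face l T) \<le> card T" "card (max_face l S) \<le> card S"
    using fin by (simp_all add: card_mono max_face_subset)
  have "sumset_bound e g a (max_face l T) c (max_face l S)"
  proof (rule smaller)
    show "int e \<le> aff_dim (max_face l T + max_face l S)"
      using l dim by (simp add: facet_normals_def max_face_set_plus)
  qed (use faces card_le max_face_subset in auto)
  moreover have "sumset_bound (Suc e) g a (T - max_face l T) c S" if rest: "T - max_face l T \<noteq> {}"
  proof (rule smaller)
    have "T - max_face l T \<subset> T"
      using faces(1) max_face_subset by blast
    then show "Suc e + card (T - max_face l T) + card S < Suc e + card T + card S"
      using psubset_card_mono[OF fin(1)] by simp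
    show "int (Suc e) \<le> aff_dim (T - max_face l T + S)"
      using aff_dim_le_set_plus[OF rest, of S] False by (simp add: add.commute)
  qed (use ne rest in auto)
  ultimately show ?thesis
    by (intro sumset_bound_lighter_face[OF fin ne(1) dom l lighter])
qed

theorem sumset_bound_aff_dim:
  fixes T S :: "'a::euclidean_space set"
  assumes "finite T" "finite S" "T \<noteq> {}" "S \<noteq> {}" and "dominates_sums g a T c S"
    and "int e \<le> aff_dim (T + S)"
  shows "sumset_bound e g a T c S"
  using assms
proof (induction "e + card T + card S" arbitrary: e T S rule: less_induct)
  case less
  note fin = less.prems(1,2) and ne = less.prems(3,4) and dom = less.prems(5)
    and dim = less.prems(6)
  have smaller: "sumset_bound f g a T' c S'"
    if "f + card T' + card S' < e + card T + card S" "T' \<subseteq> T" "T' \<noteq> {}" "S' \<subseteq> S" "S' \<noteq> {}"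
      "int f \<le> aff_dim (T' + S')" for f T' S'
    using that fin dominates_sums_mono[OF dom] by (intro less.hyps) (auto intro: finite_subset)
  show ?case
  proof (cases e)
    case 0
    then show ?thesis
      using fin ne dom by (simp add: sumset_bound_0)
  next
    case (Suc e')
    obtain l where l: "l \<in> facet_normals (T + S)"
      using facet_normals_nonempty[of "T + S"] fin dim Suc by (auto simp: finite_set_plus)
    show ?thesis
    proof (cases "sum a (max_face l T) \<le> sum c (max_face l S)")
      case True
      then show ?thesis
        unfolding Suc using fin ne dom dim l smaller
        by (intro sumset_bound_step) (auto simp: Suc)
    next
      case False
      have "sumset_bound (Suc e') g c S a T"
      proof (rule sumset_bound_step)
        show "sumset_bound f g c S' a T'"
          if "f + card S' + card T' < Suc e' + card S + card T" "S' \<subseteq> S" "S' \<noteq> {}"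
            "T' \<subseteq> T" "T' \<noteq> {}" "int f \<le> aff_dim (S' + T')" for f S' T'
          using smaller[of f T' S'] that
          by (simp add: Suc sumset_bound_commute[of f g c] add.commute add.left_commute)
      qed (use fin ne dom dim l False Suc dominates_sums_commute[of g a T c S]
          in \<open>auto simp: add.commute\<close>)
      then show ?thesis
        unfolding Suc by (simp add: sumset_bound_commute[of _ g c])
    qed
  qed
qed

section \<open>Weighted difference sets\<close>

lemma diffset_eq_set_plus:
  fixes T S :: "'a::ab_group_add set"
  shows "diffset T S = T + uminus ` S"
  by (auto simp: diffset_def set_plus_def)

lemma finite_diffset: "finite A \<Longrightarrow> finite B \<Longrightarrow> finite (diffset A B)"
  unfolding diffset_def by (simp add: finite_image_set2)

lemma diffset_mono: "A \<subseteq> A' \<Longrightarrow> B \<subseteq> B' \<Longrightarrow> diffset A B \<subseteq> diffset A' B'"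
  unfolding diffset_def by blast

lemma uminus_image_diffset:
  fixes T S :: "'a::ab_group_add set"
  shows "uminus ` diffset T S = diffset S T"
  by (force simp: diffset_def image_iff)

lemma max_face_uminus_image: "max_face l (uminus ` S) = uminus ` max_face (- l) S"
  by (auto simp: max_face_def)

lemma max_face_diffset: "max_face l (diffset T S) = diffset (max_face l T) (max_face (- l) S)"
  by (simp add: diffset_eq_set_plus max_face_set_plus max_face_uminus_image)

lemma diff_in_max_face_iff:
  assumes "t \<in> T" "s \<in> S"
  shows "t - s \<in> max_face l (diffset T S) \<longleftrightarrow> t \<in> max_face l T \<and> s \<in> max_face (- l) S"
  using plus_in_max_face_iff[of t T "- s" "uminus ` S" l] assms
  by (auto simp: diffset_eq_set_plus max_face_uminus_image)

definition dominates_diffs :: "('a::minus \<Rightarrow> real) \<Rightarrow> ('a \<Rightarrow> real) \<Rightarrow> 'a set \<Rightarrow> bool" where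
  "dominates_diffs g a B \<longleftrightarrow>
     (\<forall>b\<in>B. 0 \<le> a b) \<and> (\<forall>b\<in>B. \<forall>b'\<in>B. a b + a b' \<le> g (b - b'))"

lemma dominates_diffs_mono: "dominates_diffs g a B \<Longrightarrow> B' \<subseteq> B \<Longrightarrow> dominates_diffs g a B'"
  by (simp add: dominates_diffs_def subset_iff)

lemma dominates_diffs_nonneg:
  assumes "dominates_diffs g a B" and "x \<in> diffset B B"
  shows "0 \<le> g x"
proof -
  obtain b b' where "b \<in> B" "b' \<in> B" "x = b - b'"
    using assms(2) by (auto simp: diffset_def)
  moreover from this have "0 \<le> a b + a b'" "a b + a b' \<le> g (b - b')"
    using assms(1) by (auto simp: dominates_diffs_def)
  ultimately show ?thesis
    by simp
qed

lemma sum_opposite_diffsets_ge: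
  fixes B :: "'a::euclidean_space set"
  assumes "finite B" and dom: "dominates_diffs g a B"
    and sub: "T \<subseteq> B" "S \<subseteq> B" and ne: "T \<noteq> {}" "S \<noteq> {}"
    and dim: "int e \<le> aff_dim T" and lighter: "sum a S \<le> sum a T"
  shows "2 * (sum a T + real (Suc e) * sum a S) \<le> sum g (diffset T S) + sum g (diffset S T)"
proof -
  have fin: "finite T" "finite S"
    using assms(1) sub by (auto intro: finite_subset)
  define h where "h x = g x + g (- x)" for x
  let ?a = "\<lambda>b. 2 * a b" and ?c = "\<lambda>b. 2 * a (- b)"
  have "sumset_bound e h ?a T ?c (uminus ` S)"
  proof (rule sumset_bound_aff_dim)
    show "dominates_sums h ?a T ?c (uminus ` S)"
      unfolding dominates_sums_def
    proof (intro conjI ballI)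
      fix t s assume "t \<in> T" "s \<in> uminus ` S"
      then have "t \<in> B" "- s \<in> B"
        using sub by auto
      then have "a t + a (- s) \<le> g (t - (- s))" "a (- s) + a t \<le> g (- s - t)"
        using dom unfolding dominates_diffs_def by blast+
      then show "2 * a t + 2 * a (- s) \<le> h (t + s)"
        by (simp add: h_def algebra_simps)
    qed (use dom sub in \<open>auto simp: dominates_diffs_def\<close>)
    show "int e \<le> aff_dim (T + uminus ` S)"
      using dim aff_dim_le_set_plus[of "uminus ` S" T] ne(2) by simp
  qed (use fin ne in auto)
  moreover have "sum ?a T = 2 * sum a T" "sum ?c (uminus ` S) = 2 * sum a S"
    by (simp_all add: sum.reindex sum_distrib_left)
  moreover have "sum h (T + uminus ` S) = sum g (diffset T S) + sum g (diffset S T)"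
    unfolding uminus_image_diffset[of T S, symmetric]
    by (simp add: h_def sum.distrib sum.reindex diffset_eq_set_plus)
  ultimately show ?thesis
    using lighter by (simp add: sumset_bound_def min_absorb2 algebra_simps)
qed

lemma sum_opposite_faces_plus_rest_le:
  fixes B :: "'a::real_inner set"
  assumes "finite B" and nonneg: "\<And>x. x \<in> diffset B B \<Longrightarrow> (0::real) \<le> g x"
    and T: "T = max_face l B" "T \<noteq> B" and S: "S = max_face (- l) B"
  shows "sum g (diffset T S) + sum g (diffset S T) + sum g (diffset (B - S) (B - S) - {0})
    \<le> sum g (diffset B B - {0})"
proof -
  let ?D = "diffset B B" and ?R = "diffset (B - S) (B - S) - {0}"
  have TS: "diffset T S = max_face l ?D" and ST: "diffset S T = max_face (- l) ?D"
    by (simp_all add: T(1) S max_face_diffset)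
  have "T \<inter> S = {}"
    using max_face_disjoint_opposite T S by blast
  moreover have "B \<noteq> {}"
    using T(2) max_face_subset unfolding T(1) by fastforce
  ultimately have zero: "0 \<notin> diffset T S" "0 \<notin> diffset S T" "0 \<in> ?D"
    by (auto simp: diffset_def)
  have "diffset T S \<inter> diffset S T = {}"
    unfolding TS ST using zero TS by (intro max_face_disjoint_opposite) auto
  moreover have "(diffset T S \<union> diffset S T) \<inter> ?R = {}"
    unfolding TS ST using diff_in_max_face_iff[of _ B _ B] S by (fastforce simp: diffset_def)
  ultimately have "sum g (diffset T S) + sum g (diffset S T) + sum g ?R
      = sum g (diffset T S \<union> diffset S T \<union> ?R)"
    using assms(1) by (simp add: sum.union_disjoint finite_diffset finite_max_face T(1) S)
  also have "\<dots> \<le> sum g (?D - {0})"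
  proof (rule sum_mono2)
    show "diffset T S \<union> diffset S T \<union> ?R \<subseteq> ?D - {0}"
      using zero max_face_subset[of _ ?D] diffset_mono[of "B - S" B "B - S" B] TS ST by blast
  qed (use assms(1) nonneg in \<open>auto simp: finite_diffset\<close>)
  finally show ?thesis .
qed

lemma sum_diffset_remove_opposite_face:
  fixes B :: "'a::euclidean_space set"
  assumes "finite B" and dom: "dominates_diffs g a B" and dim: "aff_dim B = int (Suc e)"
    and l: "l \<in> facet_normals B" and T: "T = max_face l B" and S: "S = max_face (- l) B"
    and lighter: "sum a S \<le> sum a T"
  shows "2 * (sum a T + real (Suc e) * sum a S) + sum g (diffset (B - S) (B - S) - {0})
    \<le> sum g (diffset B B - {0})"
proof -
  have "B \<noteq> {}"
    using dim by auto
  then have "T \<noteq> {}" "S \<noteq> {}"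
    using assms(1) by (simp_all add: T S max_face_nonempty)
  moreover have "T \<subseteq> B" "S \<subseteq> B"
    by (simp_all add: T S max_face_subset)
  moreover have "int e \<le> aff_dim T"
    using l dim by (simp add: facet_normals_def T)
  ultimately have "2 * (sum a T + real (Suc e) * sum a S)
      \<le> sum g (diffset T S) + sum g (diffset S T)"
    using lighter by (intro sum_opposite_diffsets_ge[OF assms(1) dom])
  moreover have "T \<noteq> B"
    using facet_normal_max_face_neq[OF l] by (simp add: T)
  with assms(1) dominates_diffs_nonneg[OF dom] T
  have "sum g (diffset T S) + sum g (diffset S T) + sum g (diffset (B - S) (B - S) - {0})
      \<le> sum g (diffset B B - {0})"
    using S by (rule sum_opposite_faces_plus_rest_le)
  ultimately show ?thesis
    by simp
qed

lemma heaviest_facet_exists: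
  fixes B :: "'a::euclidean_space set" and a :: "'a \<Rightarrow> real"
  assumes "finite B" and "1 \<le> aff_dim B" and nonneg: "\<And>b. b \<in> B \<Longrightarrow> 0 \<le> a b"
  shows "\<exists>l\<in>facet_normals B. \<forall>l'. max_face l' B \<noteq> B \<longrightarrow>
    sum a (max_face l' B) \<le> sum a (max_face l B)"
proof -
  let ?facets = "(\<lambda>l. max_face l B) ` facet_normals B"
  have fin: "finite ?facets"
    by (rule finite_subset[of _ "Pow B"]) (use assms(1) max_face_subset in auto)
  then obtain T where T: "T \<in> ?facets" "(MAX F\<in>?facets. sum a F) = sum a T"
    using obtains_MAX facet_normals_nonempty[OF assms(1,2)] by (metis image_is_empty)
  have "sum a (max_face l' B) \<le> sum a T" if "max_face l' B \<noteq> B" for l'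
  proof -
    obtain l'' where l'': "l'' \<in> facet_normals B" "max_face l' B \<subseteq> max_face l'' B"
      using max_face_subset_facet[OF assms(1) \<open>max_face l' B \<noteq> B\<close>] .
    have "sum a (max_face l' B) \<le> sum a (max_face l'' B)"
      using l''(2) assms(1)
      by (intro sum_mono2 nonneg) (auto simp: finite_max_face max_face_subset[THEN subsetD])
    also have "\<dots> \<le> sum a T"
      unfolding T(2)[symmetric] using fin l''(1) by (intro Max_ge) auto
    finally show ?thesis .
  qed
  then show ?thesis
    using T(1) by auto
qed

lemma facet_heavier_than_opposite_exists:
  fixes B :: "'a::euclidean_space set" and a :: "'a \<Rightarrow> real"
  assumes "finite B" and "1 \<le> aff_dim B" and "\<And>b. b \<in> B \<Longrightarrow> 0 \<le> a b"
  obtains l where "l \<in> facet_normals B" "sum a (max_face (- l) B) \<le> sum a (max_face l B)"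
proof -
  obtain l where l: "l \<in> facet_normals B"
    and heaviest: "\<And>l'. max_face l' B \<noteq> B \<Longrightarrow> sum a (max_face l' B) \<le> sum a (max_face l B)"
    using heaviest_facet_exists[OF assms(1,2), of a] assms(3) by blast
  have "max_face l B \<inter> max_face (- l) B = {}"
    using l by (intro max_face_disjoint_opposite facet_normal_max_face_neq)
  moreover have "max_face l B \<noteq> {}"
    using assms(1,2) by (intro max_face_nonempty) auto
  ultimately have "max_face (- l) B \<noteq> B"
    using max_face_subset[of l B] by blast
  then show ?thesis
    using that[OF l] heaviest by blast
qed

lemma sum_diffset_without_opposite_face_ge:
  fixes B :: "'a::euclidean_space set"
  assumes "finite B" and nonneg: "\<And>b. b \<in> B \<Longrightarrow> 0 \<le> a b" and dim: "aff_dim B = int (Suc e)"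
    and l: "l \<in> facet_normals B" and T: "T = max_face l B" and S: "S = max_face (- l) B"
    and smaller: "\<And>B' m. \<lbrakk>B' \<subset> B; aff_dim B' = int m\<rbrakk>
      \<Longrightarrow> 2 * real m * sum a B' \<le> sum g (diffset B' B' - {0})"
  shows "2 * real (Suc e) * sum a (B - S)
    \<le> 2 * sum a T + sum g (diffset (B - S) (B - S) - {0})"
proof -
  have "T \<noteq> B" "T \<inter> S = {}"
    using facet_normal_max_face_neq[OF l] max_face_disjoint_opposite unfolding T S by blast+
  have sub: "T \<subseteq> B" "S \<subseteq> B"
    by (simp_all add: T S max_face_subset)
  show ?thesis
  proof (cases "aff_dim (B - S) = aff_dim B")
    case True
    have "S \<noteq> {}"
      unfolding S using assms(1) dim by (intro max_face_nonempty) auto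
    then have "2 * real (Suc e) * sum a (B - S) \<le> sum g (diffset (B - S) (B - S) - {0})"
      using True sub(2) dim by (intro smaller) auto
    moreover have "0 \<le> sum a T"
      using nonneg sub(1) by (auto intro: sum_nonneg)
    ultimately show ?thesis
      by simp
  next
    case False
    then have "B - S = T"
      unfolding T using l \<open>T \<inter> S = {}\<close> sub aff_dim_subset[of "B - S" B]
      by (intro eq_facetI) (auto simp: T)
    moreover have "2 * real e * sum a T \<le> sum g (diffset T T - {0})"
      using sub(1) \<open>T \<noteq> B\<close> l dim by (intro smaller) (auto simp: T facet_normals_def)
    ultimately show ?thesis
      by (simp add: algebra_simps)
  qed
qed

theorem sum_diffset_ge:
  fixes B :: "'a::euclidean_space set"
  assumes "finite B" and "aff_dim B = int n" and "dominates_diffs g a B"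
  shows "2 * real n * sum a B \<le> sum g (diffset B B - {0})"
  using assms
proof (induction B arbitrary: n rule: finite_psubset_induct)
  case (psubset B)
  note dom = psubset.prems(2)
  have nonneg: "0 \<le> a b" if "b \<in> B" for b
    using dom that by (simp add: dominates_diffs_def)
  show ?case
  proof (cases n)
    case 0
    then show ?thesis
      using dominates_diffs_nonneg[OF dom] by (auto intro: sum_nonneg)
  next
    case (Suc e)
    then have dim: "aff_dim B = int (Suc e)" "1 \<le> aff_dim B"
      using psubset.prems(1) by simp_all
    obtain l where l: "l \<in> facet_normals B"
      and lighter: "sum a (max_face (- l) B) \<le> sum a (max_face l B)"
      using facet_heavier_than_opposite_exists[OF psubset.hyps dim(2)] nonneg by metis
    define T S where T: "T = max_face l B" and S: "S = max_face (- l) B"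
    have "2 * (sum a T + real n * sum a S) + sum g (diffset (B - S) (B - S) - {0})
        \<le> sum g (diffset B B - {0})"
      unfolding Suc using l T S lighter
      by (intro sum_diffset_remove_opposite_face[OF psubset.hyps dom dim(1)]) auto
    moreover have "2 * real n * sum a (B - S)
        \<le> 2 * sum a T + sum g (diffset (B - S) (B - S) - {0})"
      unfolding Suc
    proof (rule sum_diffset_without_opposite_face_ge[OF psubset.hyps nonneg dim(1) l T S])
      show "2 * real m * sum a B' \<le> sum g (diffset B' B' - {0})"
        if "B' \<subset> B" "aff_dim B' = int m" for B' m
        using that dominates_diffs_mono[OF dom] by (intro psubset.IH) auto
    qed
    moreover have "sum a B = sum a (B - S) + sum a S"
      using psubset.hyps by (simp add: sum.subset_diff[of S B] S max_face_subset)
    ultimately show ?thesis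
      by (simp add: algebra_simps)
  qed
qed

section \<open>Difference sets and fibres of projections along a line\<close>

lemma card_diffset_ge:
  fixes X Y :: "'a::linordered_ab_group_add set"
  assumes "finite X" "finite Y" "X \<noteq> {}" "Y \<noteq> {}"
  shows "card X + card Y \<le> card (diffset X Y) + 1"
proof -
  let ?P = "(\<lambda>x. x - Max Y) ` X" and ?Q = "(\<lambda>y. Max X - y) ` Y"
  have "?P \<inter> ?Q \<subseteq> {Max X - Max Y}"
  proof
    fix z assume "z \<in> ?P \<inter> ?Q"
    then obtain x y where xy: "x \<in> X" "y \<in> Y" "z = x - Max Y" "z = Max X - y"
      by blast
    have "z \<le> Max X - Max Y"
      using xy(1,3) assms by (simp add: diff_right_mono)
    moreover have "Max X - Max Y \<le> z"
      using xy(2,4) assms by (simp add: diff_left_mono)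
    ultimately show "z \<in> {Max X - Max Y}"
      by simp
  qed
  then have "card (?P \<inter> ?Q) \<le> 1"
    using card_mono[of "{Max X - Max Y}"] by simp
  moreover have "card ?P = card X" "card ?Q = card Y"
    by (simp_all add: card_image inj_on_def)
  moreover have "card ?P + card ?Q = card (?P \<union> ?Q) + card (?P \<inter> ?Q)"
    using assms by (intro card_Un_Int) auto
  moreover have "card (?P \<union> ?Q) \<le> card (diffset X Y)"
    using assms Max_in[OF assms(1,3)] Max_in[OF assms(2,4)]
    by (intro card_mono finite_diffset) (unfold diffset_def, blast+)
  ultimately show ?thesis
    by simp
qed

lemma line_through_0_eq_span: "line_through_0 v = span {v}"
  by (auto simp: line_through_0_def span_singleton)

lemma card_fibre_diffset_ge:
  fixes A :: "'a::euclidean_space set"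
  assumes q: "projection_along (line_through_0 v) q" and "finite A"
    and "b \<in> q ` A" "b' \<in> q ` A"
  shows "card (fibre q A b) + card (fibre q A b') \<le> card (fibre q (diffset A A) (b - b')) + 1"
proof -
  let ?h = "\<lambda>x. x \<bullet> v" and ?F = "fibre q A"
  have "inj_on ?h (?F b)" for b
  proof (rule inj_onI)
    fix x y assume "x \<in> ?F b" "y \<in> ?F b" and h: "?h x = ?h y"
    then have "x - y \<in> line_through_0 v"
      using projection_along_eq_iff[OF q, of x y] by (simp add: fibre_def)
    then obtain c where c: "x - y = c *\<^sub>R v"
      by (auto simp: line_through_0_def)
    then have "c * (v \<bullet> v) = 0"
      using h by (metis inner_diff_left inner_scaleR_left right_minus_eq)
    then show "x = y"
      using c by auto
  qed
  then have "card (?F b) + card (?F b') = card (?h ` ?F b) + card (?h ` ?F b')"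
    by (simp add: card_image)
  also have "\<dots> \<le> card (diffset (?h ` ?F b) (?h ` ?F b')) + 1"
    using assms(2-4) by (intro card_diffset_ge) (auto simp: fibre_def)
  also have "diffset (?h ` ?F b) (?h ` ?F b') = ?h ` diffset (?F b) (?F b')"
    by (force simp: diffset_def inner_diff_left)
  also have "card \<dots> \<le> card (diffset (?F b) (?F b'))"
    using assms(2) by (intro card_image_le finite_diffset) (simp_all add: fibre_def)
  also have "\<dots> \<le> card (fibre q (diffset A A) (b - b'))"
  proof (rule card_mono)
    show "diffset (?F b) (?F b') \<subseteq> fibre q (diffset A A) (b - b')"
      using q by (auto simp: fibre_def diffset_def projection_along_def linear_diff)
  qed (use assms(2) in \<open>simp add: fibre_def finite_diffset\<close>)
  finally show ?thesis
    by simp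
qed

lemma dominates_diffs_card_fibre:
  fixes A :: "'a::euclidean_space set"
  assumes "projection_along (line_through_0 v) q" and "finite A"
  shows "dominates_diffs (\<lambda>y. real (card (fibre q (diffset A A) y)))
    (\<lambda>b. real (card (fibre q A b)) - 1) (q ` A)"
  unfolding dominates_diffs_def
proof (intro conjI ballI)
  fix b assume "b \<in> q ` A"
  then have "fibre q A b \<noteq> {}" "finite (fibre q A b)"
    using assms(2) by (auto simp: fibre_def)
  then show "0 \<le> real (card (fibre q A b)) - 1"
    by (simp add: Suc_leI card_gt_0_iff)
next
  fix b b' assume "b \<in> q ` A" "b' \<in> q ` A"
  then show "real (card (fibre q A b)) - 1 + (real (card (fibre q A b')) - 1)
      \<le> real (card (fibre q (diffset A A) (b - b')))"
    using card_fibre_diffset_ge[OF assms, of b b'] by simp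
qed

lemma card_diffset_minus_kernel_eq_sum:
  assumes q: "projection_along U q" and "finite A"
  shows "card (diffset A A - U)
    = (\<Sum>y\<in>diffset (q ` A) (q ` A) - {0}. card (fibre q (diffset A A) y))"
proof -
  have zero: "x \<in> U \<longleftrightarrow> q x = 0" for x
    using projection_along_eq_0_iff[OF q] by simp
  let ?D = "diffset A A - U"
  have "q ` ?D \<subseteq> diffset (q ` A) (q ` A) - {0}"
    using q by (fastforce simp: zero diffset_def projection_along_def linear_diff)
  then have "card ?D = (\<Sum>y\<in>diffset (q ` A) (q ` A) - {0}. card (fibre q ?D y))"
    using assms(2) by (intro card_eq_sum_card_fibres) (auto simp: finite_diffset)
  also have "\<dots> = (\<Sum>y\<in>diffset (q ` A) (q ` A) - {0}. card (fibre q (diffset A A) y))"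
    by (intro sum.cong arg_cong[where f = card]) (auto simp: fibre_def zero)
  finally show ?thesis .
qed

lemma card_diffset_minus_line_ge_fibres:
  fixes A :: "'a::euclidean_space set"
  assumes q: "projection_along (line_through_0 v) q" and "finite A" "A \<noteq> {}"
  shows "2 * aff_dim (q ` A) * (int (card A) - int (card (q ` A)))
    \<le> int (card (diffset A A - line_through_0 v))"
proof -
  obtain n where n: "aff_dim (q ` A) = int n"
    using assms(3) by (metis aff_dim_negative_iff image_is_empty nonneg_int_cases not_less)
  have "2 * real n * (real (card A) - real (card (q ` A)))
      = 2 * real n * (\<Sum>b\<in>q ` A. real (card (fibre q A b)) - 1)"
    using assms(2) by (simp add: sum_subtractf card_eq_sum_card_fibres[of A "q ` A" q])
  also have "\<dots> \<le> (\<Sum>y\<in>diffset (q ` A) (q ` A) - {0}. real (card (fibre q (diffset A A) y)))"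
    using assms(2) n dominates_diffs_card_fibre[OF q assms(2)] by (intro sum_diffset_ge) auto
  also have "\<dots> = real (card (diffset A A - line_through_0 v))"
    by (simp add: card_diffset_minus_kernel_eq_sum[OF q assms(2)])
  finally have "real_of_int (2 * int n * (int (card A) - int (card (q ` A))))
      \<le> real_of_int (int (card (diffset A A - line_through_0 v)))"
    by simp
  then show ?thesis
    by (simp only: of_int_le_iff n)
qed

lemma card_projection_le_translates:
  assumes q: "projection_along U q" and "A \<subseteq> (\<Union>i\<in>I. (\<lambda>x. t i + x) ` U)" and "finite I"
  shows "card (q ` A) \<le> card I"
proof -
  have "q ` A \<subseteq> (\<lambda>i. q (t i)) ` I"
  proof
    fix b assume "b \<in> q ` A"
    then obtain i u where "i \<in> I" "u \<in> U" "b = q (t i + u)"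
      using assms(2) by blast
    then show "b \<in> (\<lambda>i. q (t i)) ` I"
      using projection_along_eq_iff[OF q, of "t i + u" "t i"] by auto
  qed
  then show ?thesis
    using assms(3) by (rule surj_card_le[rotated])
qed

theorem card_diffset_minus_line_ge:
  fixes A :: "'a::euclidean_space set"
  assumes "finite A" and "1 \<le> aff_dim A"
    and cover: "A \<subseteq> (\<Union>i\<in>I. (\<lambda>x. t i + x) ` line_through_0 v)" and "finite I"
  shows "2 * (aff_dim A - 1) * (int (card A) - int (card I))
    \<le> int (card (diffset A A - line_through_0 v))"
proof -
  obtain q where q: "projection_along (line_through_0 v) q"
    using projection_along_exists[of "span {v}"] by (auto simp: line_through_0_eq_span)
  have "aff_dim A \<le> aff_dim (q ` A) + int (dim (line_through_0 v))"
    using q by (intro aff_dim_le_projection_along) (simp_all add: line_through_0_eq_span)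
  moreover have "dim (line_through_0 v) \<le> 1"
    using dim_le_card[of "line_through_0 v" "{v}"] by (simp add: line_through_0_eq_span)
  ultimately have "aff_dim A - 1 \<le> aff_dim (q ` A)"
    by simp
  have "card (q ` A) \<le> card A"
    using assms(1) by (rule card_image_le)
  have "2 * (aff_dim A - 1) * (int (card A) - int (card I))
      \<le> 2 * (aff_dim A - 1) * (int (card A) - int (card (q ` A)))"
    using card_projection_le_translates[OF q cover assms(4)] assms(2)
    by (intro mult_left_mono) auto
  also have "\<dots> \<le> 2 * aff_dim (q ` A) * (int (card A) - int (card (q ` A)))"
    using \<open>aff_dim A - 1 \<le> aff_dim (q ` A)\<close> \<open>card (q ` A) \<le> card A\<close>
    by (intro mult_right_mono) auto
  also have "\<dots> \<le> int (card (diffset A A - line_through_0 v))"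
    using assms(2) by (intro card_diffset_minus_line_ge_fibres[OF q assms(1)]) auto
  finally show ?thesis .
qed

theorem theorem1p3:
  fixes A :: "(real ^ 'd) set" and v :: "real ^ 'd"
    and r :: nat and t :: "nat \<Rightarrow> real ^ 'd"
  assumes "finite A" and "A \<noteq> {}"
    and "aff_dim A = int CARD('d)"
    and "v \<noteq> 0"
    and "A \<subseteq> (\<Union>i<r. (\<lambda>x. t i + x) ` line_through_0 v)"
  shows "int (card (diffset A A - line_through_0 v))
    \<ge> (2 * int CARD('d) - 2) * int (card A) - 2 * (int CARD('d))\<^sup>2 * int r"
proof -
  let ?d = "int CARD('d)"
  have d: "1 \<le> ?d"
    by (simp add: Suc_leI)
  have "2 * (?d - 1) * (int (card A) - int r) \<le> int (card (diffset A A - line_through_0 v))"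
    using card_diffset_minus_line_ge[OF assms(1) _ assms(5)] assms(3) d by simp
  moreover have "(2 * ?d - 2) * int r \<le> 2 * ?d\<^sup>2 * int r"
    using d by (intro mult_right_mono)
      (auto simp: power2_eq_square intro: order.trans[of _ "2 * ?d"])
  ultimately show ?thesis
    by (simp add: algebra_simps)
qed

end
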